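(* Let $p$ be an odd prime, $\omega$ a primitive $p$th root of unity and $K=\mathbb{Q}(\omega)$. Let $\alpha\in K$ and let $\alpha_1,\dots,\alpha_n$ be the distinct Galois conjugates of $\alpha$ over $\mathbb{Q}$ (the distinct elements $\sigma(\alpha)$, $\sigma\in\operatorname{Gal}(K/\mathbb{Q})$), with $\alpha_1=\alpha$. Suppose $\beta\in K$ satisfies $$d(\alpha,\beta)<\tfrac12\, d(\alpha,\alpha_i)\quad\text{for } i=2,\dots,n.$$ Then $\mathbb{Q}(\alpha)\subseteq\mathbb{Q}(\beta)$.
   Context: $\operatorname{Tr}_{K/\mathbb{Q}}(\alpha)=\sum_{\sigma\in\operatorname{Gal}(K/\mathbb{Q})}\sigma(\alpha)$. For $\alpha\in K$, $\|\alpha\|=\sqrt{\sum_{j=1}^{p-1}\operatorname{Tr}_{K/\mathbb{Q}}(\alpha\omega^j)^2}$, and $d(\alpha,\beta)=\|\alpha-\beta\|$. *)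

theory Defs
  imports
    Complex_Main
    "HOL-Library.FuncSet"
    "HOL-Algebra.Generated_Fields"
    "HOL-Algebra.Algebraic_Closure_Type"
begin

text \<open>All number fields are subfields of the field of complex numbers, which
  \<^term>\<open>ring_of_type_algebra\<close> provides as a structure with carrier \<^term>\<open>UNIV\<close>.\<close>

abbreviation complex_field :: "complex ring" where
  "complex_field \<equiv> ring_of_type_algebra"

definition rat_adjoin :: "complex set \<Rightarrow> complex set" where
  "rat_adjoin S = generate_field complex_field (\<rat> \<union> S)"

definition primitive_root_of_unity :: "nat \<Rightarrow> complex \<Rightarrow> bool" where
  "primitive_root_of_unity n w \<longleftrightarrow> n > 0 \<and> w ^ n = 1 \<and> (\<forall>k. 0 < k \<and> k < n \<longrightarrow> w ^ k \<noteq> 1)"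

text \<open>The automorphisms are taken extensional on \<^term>\<open>K\<close>, so that each of them is
  represented by exactly one function and sums over the Galois group count it once.\<close>

definition galois_group_rat :: "complex set \<Rightarrow> (complex \<Rightarrow> complex) set" where
  "galois_group_rat K =
     {\<sigma> \<in> extensional K.
        \<sigma> \<in> ring_iso (complex_field\<lparr>carrier := K\<rparr>) (complex_field\<lparr>carrier := K\<rparr>) \<and>
        (\<forall>q\<in>\<rat>. \<sigma> q = q)}"

definition galois_conjugates :: "complex set \<Rightarrow> complex \<Rightarrow> complex set" where
  "galois_conjugates K \<alpha> = (\<lambda>\<sigma>. \<sigma> \<alpha>) ` galois_group_rat K"

definition galois_trace :: "complex set \<Rightarrow> complex \<Rightarrow> complex" where
  "galois_trace K \<alpha> = (\<Sum>\<sigma>\<in>galois_group_rat K. \<sigma> \<alpha>)"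

text \<open>For \<open>\<alpha> \<in> \<rat>(\<omega>)\<close> the traces below are rational numbers; \<^term>\<open>Re\<close> only
  changes their type from complex to real.\<close>

definition cyclotomic_norm :: "nat \<Rightarrow> complex \<Rightarrow> complex \<Rightarrow> real" where
  "cyclotomic_norm p \<omega> \<alpha> =
     sqrt (\<Sum>j = 1..p - 1. (Re (galois_trace (rat_adjoin {\<omega>}) (\<alpha> * \<omega> ^ j)))\<^sup>2)"

definition cyclotomic_dist :: "nat \<Rightarrow> complex \<Rightarrow> complex \<Rightarrow> complex \<Rightarrow> real" where
  "cyclotomic_dist p \<omega> \<alpha> \<beta> = cyclotomic_norm p \<omega> (\<alpha> - \<beta>)"

end

theory Submission
  imports Defs "HOL-Analysis.L2_Norm"
begin

text \<open>This is Krasner's argument. The norm is invariant under the Galois group, because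
  the trace is and because an automorphism permutes the nontrivial \<open>p\<close>-th roots of unity. If
  \<open>\<alpha> \<notin> \<rat>(\<beta>)\<close>, some \<open>\<sigma>\<close> fixes \<open>\<beta>\<close> and moves \<open>\<alpha>\<close>, whence
  \<open>d(\<alpha>, \<sigma>\<alpha>) \<le> d(\<alpha>, \<beta>) + d(\<sigma>\<beta>, \<sigma>\<alpha>) = 2 d(\<alpha>, \<beta>)\<close>, contrary to the assumption.\<close>

section \<open>Subfields of an ambient field and polynomials over them\<close>

text \<open>Working with subsets lets several fields live inside one type, so that a polynomial over
  \<open>F\<close> is also a polynomial over a larger \<open>K\<close>. As
  \<open>inverse 0 = 0\<close>, the law for inverses is stated without an exception at zero.\<close>

locale subfield_set =
  fixes F :: "'a::field set"
  assumes one_mem: "1 \<in> F"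
    and diff_mem: "x \<in> F \<Longrightarrow> y \<in> F \<Longrightarrow> x - y \<in> F"
    and mult_mem: "x \<in> F \<Longrightarrow> y \<in> F \<Longrightarrow> x * y \<in> F"
    and inverse_mem: "x \<in> F \<Longrightarrow> inverse x \<in> F"
begin

lemma zero_mem: "0 \<in> F"
  using diff_mem[OF one_mem one_mem] by simp

lemma uminus_mem: "x \<in> F \<Longrightarrow> - x \<in> F"
  using diff_mem[OF zero_mem] by simp

lemma add_mem: "x \<in> F \<Longrightarrow> y \<in> F \<Longrightarrow> x + y \<in> F"
  using diff_mem[OF _ uminus_mem] by simp

lemma sum_mem: "(\<And>i. i \<in> A \<Longrightarrow> f i \<in> F) \<Longrightarrow> sum f A \<in> F"
  by (induction A rule: infinite_finite_induct) (auto intro: zero_mem add_mem)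

lemma power_mem: "x \<in> F \<Longrightarrow> x ^ n \<in> F"
  by (induction n) (auto intro: one_mem mult_mem)

text \<open>This is F[X], kept inside the polynomials over the ambient field so that its members can
  be evaluated at points outside \<open>F\<close>.\<close>

definition polys :: "'a poly set" where
  "polys = {g. \<forall>i. coeff g i \<in> F}"

lemma polys_diff: "g \<in> polys \<Longrightarrow> h \<in> polys \<Longrightarrow> g - h \<in> polys"
  by (auto simp: polys_def intro: diff_mem)

lemma polys_add: "g \<in> polys \<Longrightarrow> h \<in> polys \<Longrightarrow> g + h \<in> polys"
  by (auto simp: polys_def intro: add_mem)

lemma polys_mult: "g \<in> polys \<Longrightarrow> h \<in> polys \<Longrightarrow> g * h \<in> polys"
  by (auto simp: polys_def coeff_mult intro!: sum_mem mult_mem)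

lemma polys_monom: "c \<in> F \<Longrightarrow> monom c n \<in> polys"
  by (auto simp: polys_def intro: zero_mem)

lemma polys_const: "c \<in> F \<Longrightarrow> [:c:] \<in> polys"
  using polys_monom[of c 0] by (simp add: monom_0)

lemma polys_pcompose: "g \<in> polys \<Longrightarrow> h \<in> polys \<Longrightarrow> pcompose g h \<in> polys"
proof (induction g)
  case 0
  then show ?case by simp
next
  case (pCons c g)
  then have "c \<in> F" "g \<in> polys"
    by (auto simp: polys_def coeff_pCons split: nat.splits)
  then show ?case
    using pCons by (auto simp: pcompose_pCons intro: polys_add polys_const polys_mult)
qed

lemma poly_mem: "g \<in> polys \<Longrightarrow> x \<in> F \<Longrightarrow> poly g x \<in> F"
  unfolding poly_altdef by (auto simp: polys_def intro!: sum_mem mult_mem power_mem)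

text \<open>Long division, by induction on the degree of \<open>g\<close>: a monomial multiple of
  \<open>m\<close> cancels the leading term, and its coefficient is a quotient of elements of
  \<open>F\<close>, so quotient and remainder stay over \<open>F\<close>.\<close>

lemma polys_division:
  assumes "m \<in> polys" "0 < degree m" "g \<in> polys"
  shows "\<exists>q\<in>polys. \<exists>r\<in>polys. g = q * m + r \<and> degree r < degree m"
  using assms(3)
proof (induction "degree g" arbitrary: g rule: less_induct)
  case less
  show ?case
  proof (cases "degree g < degree m")
    case True
    have "0 \<in> polys" using polys_const[OF zero_mem] by simp
    then show ?thesis using True less.prems by (intro bexI[of _ 0] bexI[of _ g]) auto
  next
    case False
    define c where "c = monom (lead_coeff g * inverse (lead_coeff m)) (degree g - degree m)"
    have c: "c \<in> polys"
    proof -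
      have "lead_coeff g \<in> F" "lead_coeff m \<in> F"
        using less.prems assms(1) by (simp_all add: polys_def)
      then show ?thesis unfolding c_def by (intro polys_monom mult_mem inverse_mem)
    qed
    have m0: "m \<noteq> 0" and g0: "g \<noteq> 0" "degree g > 0" using assms(2) False by auto
    then have cn: "c \<noteq> 0" by (auto simp: c_def)
    have dc: "degree c = degree g - degree m"
      using m0 g0 by (simp add: c_def degree_monom_eq)
    have deg: "degree (c * m) = degree g"
      using m0 cn dc False by (simp add: degree_mult_eq)
    have lead: "coeff (c * m) (degree g) = lead_coeff g"
    proof -
      have "lead_coeff (c * m) = lead_coeff c * lead_coeff m" by (rule lead_coeff_mult)
      also have "lead_coeff c = lead_coeff g * inverse (lead_coeff m)"
        unfolding dc by (simp add: c_def)
      finally show ?thesis using m0 deg by simp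
    qed
    have "degree (g - c * m) \<le> degree g" using deg by (simp add: degree_diff_le)
    moreover have "coeff (g - c * m) (degree g) = 0" using lead by simp
    \<comment> \<open>That \<open>g\<close> is not constant matters here: otherwise the difference
      would be zero, whose degree is again 0.\<close>
    ultimately have "degree (g - c * m) < degree g"
      using g0(2) by (metis le_neq_implies_less leading_coeff_0_iff degree_0)
    then obtain q r where "q \<in> polys" "r \<in> polys" "g - c * m = q * m + r" "degree r < degree m"
      using less.hyps[of "g - c * m"] polys_diff[OF less.prems polys_mult[OF c assms(1)]] by blast
    then show ?thesis
      using c by (intro bexI[of _ "q + c"] bexI[of _ r])
        (auto simp: algebra_simps intro: polys_add)
  qed
qed

end

section \<open>Minimal polynomials and simple algebraic extensions\<close>

text \<open>Least degree does the work of irreducibility: divisibility and inverses both follow from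
  it through division with remainder.\<close>

locale minimal_poly = subfield_set F for F :: "'a::field set" +
  fixes w :: 'a and m :: "'a poly"
  assumes m_polys: "m \<in> polys" and m_nonzero: "m \<noteq> 0" and m_root: "poly m w = 0"
    and m_minimal: "g \<in> polys \<Longrightarrow> g \<noteq> 0 \<Longrightarrow> poly g w = 0 \<Longrightarrow> degree m \<le> degree g"
begin

lemma degree_m_pos: "0 < degree m"
proof (rule ccontr)
  assume "\<not> 0 < degree m"
  then obtain c where "m = [:c:]" by (auto elim: degree_eq_zeroE)
  then show False using m_root m_nonzero by simp
qed

text \<open>The remainder of \<open>g\<close> modulo \<open>m\<close> also vanishes at
  \<open>w\<close>, but its degree is too small for a nonzero polynomial to do so.\<close>

lemma root_imp_multiple:
  assumes "g \<in> polys" "poly g w = 0"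
  shows "\<exists>q\<in>polys. g = q * m"
proof -
  obtain q r where qr: "q \<in> polys" "r \<in> polys" "g = q * m + r" "degree r < degree m"
    using polys_division[OF m_polys degree_m_pos assms(1)] by blast
  then have "poly r w = 0" using assms(2) m_root by simp
  then have "r = 0" using m_minimal[OF qr(2)] qr(4) by force
  then show ?thesis using qr by auto
qed

text \<open>The difference \<open>g - h\<close> is a multiple of \<open>m\<close>, so it vanishes at
  every root of \<open>m\<close>. This is what makes the substitution of \<open>w'\<close> for
  \<open>w\<close> well defined.\<close>

lemma transfer_root:
  assumes "poly m w' = 0" "g \<in> polys" "h \<in> polys" "poly g w = poly h w"
  shows "poly g w' = poly h w'"
  using root_imp_multiple[OF polys_diff[OF assms(2,3)]] assms(1,4)
  by (auto simp: diff_eq_eq)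

lemma low_degree_representative:
  assumes "g \<in> polys"
  shows "\<exists>r\<in>polys. degree r < degree m \<and> poly r w = poly g w"
proof -
  obtain q r where qr: "q \<in> polys" "r \<in> polys" "g = q * m + r" "degree r < degree m"
    using polys_division[OF m_polys degree_m_pos assms] by blast
  then show ?thesis using m_root by (intro bexI[of _ r]) auto
qed

text \<open>After reduction to \<open>degree g < degree m\<close>, a Euclidean descent: if
  \<open>m = q * g + r\<close>, then \<open>r\<close> and \<open>- q * g\<close> agree at
  \<open>w\<close>, so an inverse \<open>h\<close> for \<open>r\<close> gives the inverse
  \<open>- h * q\<close> for \<open>g\<close>. The descent ends at a nonzero constant.\<close>

lemma inverse_representative:
  assumes "g \<in> polys" "poly g w \<noteq> 0"
  shows "\<exists>h\<in>polys. poly h w * poly g w = 1"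
proof -
  have low: "\<exists>h\<in>polys. poly h w * poly g w = 1"
    if "g \<in> polys" "poly g w \<noteq> 0" "degree g < degree m" for g
    using that
  proof (induction "degree g" arbitrary: g rule: less_induct)
    case less
    show ?case
    proof (cases "degree g = 0")
      case True
      then obtain c where c: "g = [:c:]" by (auto elim: degree_eq_zeroE)
      have "coeff g 0 \<in> F" using less.prems(1) by (auto simp: polys_def)
      then have "[:inverse c:] \<in> polys" using c by (auto intro!: polys_const inverse_mem)
      then show ?thesis using c less.prems(2) by (intro bexI[of _ "[:inverse c:]"]) auto
    next
      case False
      then obtain q r where qr: "q \<in> polys" "r \<in> polys" "m = q * g + r" "degree r < degree g"
        using polys_division[OF less.prems(1) _ m_polys] by blast
      have r: "poly r w = - (poly q w * poly g w)"
        using m_root qr(3) by (simp add: eq_neg_iff_add_eq_0 add.commute)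
      \<comment> \<open>Otherwise minimality gives \<open>r = 0\<close>, so
        \<open>m = q * g\<close>; as \<open>g\<close> does not vanish at \<open>w\<close>,
        \<open>q\<close> does and has degree at least that of \<open>m\<close>, although
        \<open>g\<close> has positive degree.\<close>
      have "poly r w \<noteq> 0"
      proof
        assume "poly r w = 0"
        then have "r = 0" using m_minimal[OF qr(2)] qr(4) less.prems(3) by force
        moreover have "poly q w = 0" using r \<open>poly r w = 0\<close> less.prems(2) by simp
        ultimately have "m = q * g" "q \<noteq> 0" "g \<noteq> 0" "degree m \<le> degree q"
          using m_minimal[OF qr(1)] qr(3) m_nonzero by auto
        then show False using False degree_mult_eq[of q g] by simp
      qed
      then obtain h where "h \<in> polys" "poly h w * poly r w = 1"
        using less.hyps[OF qr(4,2)] qr(4) less.prems(3) by auto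
      moreover have "[:-1:] \<in> polys" by (intro polys_const uminus_mem one_mem)
      ultimately show ?thesis using r qr(1)
        by (intro bexI[of _ "[:-1:] * (h * q)"] polys_mult) (auto simp: mult.assoc)
    qed
  qed
  show ?thesis using low_degree_representative[OF assms(1)] low assms(2) by metis
qed

text \<open>Since \<open>w\<close> is algebraic over \<open>F\<close>, the ring F[w] is already the
  field F(w).\<close>

lemma subfield_adjoin: "subfield_set ((\<lambda>g. poly g w) ` polys)"
proof
  show "1 \<in> (\<lambda>g. poly g w) ` polys"
    using polys_const[OF one_mem] by (auto intro!: image_eqI[of _ _ "[:1:]"])
next
  fix x assume "x \<in> (\<lambda>g. poly g w) ` polys"
  then obtain g where g: "g \<in> polys" "x = poly g w" by auto
  show "inverse x \<in> (\<lambda>g. poly g w) ` polys"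
  proof (cases "x = 0")
    case True
    then show ?thesis using g by auto
  next
    case False
    then obtain h where h: "h \<in> polys" "poly h w * x = 1"
      using inverse_representative g by auto
    then have "inverse x = poly h w" using False by (simp add: inverse_eq_divide field_simps)
    then show ?thesis using h by auto
  qed
next
  fix x y assume "x \<in> (\<lambda>g. poly g w) ` polys" "y \<in> (\<lambda>g. poly g w) ` polys"
  then obtain g h where gh: "g \<in> polys" "x = poly g w" "h \<in> polys" "y = poly h w" by auto
  show "x - y \<in> (\<lambda>g. poly g w) ` polys"
    using gh by (auto intro!: image_eqI[of _ _ "g - h"] polys_diff)
  show "x * y \<in> (\<lambda>g. poly g w) ` polys"
    using gh by (auto intro!: image_eqI[of _ _ "g * h"] polys_mult)
qed

text \<open>For a root \<open>w'\<close> of \<open>m\<close> this is the embedding of F(w) over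
  \<open>F\<close> that sends \<open>w\<close> to \<open>w'\<close>. The polynomial chosen by
  \<open>SOME\<close> does not affect the value, by \<open>transfer_root\<close>; the restriction
  makes the map extensional, as \<open>galois_group_rat\<close> demands.\<close>

definition conj_map :: "'a \<Rightarrow> 'a \<Rightarrow> 'a" where
  "conj_map w' = restrict (\<lambda>x. poly (SOME g. g \<in> polys \<and> poly g w = x) w') ((\<lambda>g. poly g w) ` polys)"

lemma conj_map_poly:
  assumes "poly m w' = 0" "g \<in> polys"
  shows "conj_map w' (poly g w) = poly g w'"
proof -
  define h where "h = (SOME h. h \<in> polys \<and> poly h w = poly g w)"
  have h: "h \<in> polys \<and> poly h w = poly g w"
    unfolding h_def by (rule someI[of _ g]) (use assms in simp)
  have "conj_map w' (poly g w) = poly h w'"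
    using assms(2) by (simp add: conj_map_def h_def)
  also have "\<dots> = poly g w'"
    by (rule transfer_root) (use h assms in auto)
  finally show ?thesis .
qed

text \<open>A nonzero difference has an inverse at \<open>w\<close>; moving the identity "product
  equals 1" from \<open>w\<close> to \<open>w'\<close> shows that its image is nonzero too.\<close>

lemma inj_on_conj_map:
  assumes "poly m w' = 0"
  shows "inj_on (conj_map w') ((\<lambda>g. poly g w) ` polys)"
proof (rule inj_onI)
  fix x y
  assume "x \<in> (\<lambda>g. poly g w) ` polys" "y \<in> (\<lambda>g. poly g w) ` polys"
    and eq: "conj_map w' x = conj_map w' y"
  then obtain g h where gh: "g \<in> polys" "x = poly g w" "h \<in> polys" "y = poly h w" by auto
  have d: "g - h \<in> polys" using gh polys_diff by auto
  have z: "poly (g - h) w' = 0" using eq gh conj_map_poly[OF assms] by simp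
  show "x = y"
  proof (rule ccontr)
    assume "x \<noteq> y"
    then obtain k where k: "k \<in> polys" "poly k w * poly (g - h) w = 1"
      using inverse_representative[OF d] gh by auto
    then have "poly (k * (g - h)) w = poly [:1:] w" by simp
    then have "poly (k * (g - h)) w' = poly [:1:] w'"
      by (rule transfer_root[OF assms polys_mult[OF k(1) d] polys_const[OF one_mem]])
    then show False using z by simp
  qed
qed

end

lemma (in subfield_set) exists_minimal_poly:
  assumes "f \<in> polys" "f \<noteq> 0" "poly f w = 0"
  shows "\<exists>m. minimal_poly F w m"
proof -
  define P where "P g \<longleftrightarrow> g \<in> polys \<and> g \<noteq> 0 \<and> poly g w = 0" for g
  have "P f" using assms by (simp add: P_def)
  then have "P (arg_min degree P)" "\<And>g. P g \<Longrightarrow> degree (arg_min degree P) \<le> degree g"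
    by (auto intro: arg_min_natI arg_min_nat_le)
  then have "minimal_poly F w (arg_min degree P)"
    unfolding P_def by unfold_locales auto
  then show ?thesis ..
qed

section \<open>The complex field as a structure, and adjunction to the rationals\<close>

lemma complex_field_sel:
  "carrier complex_field = UNIV" "monoid.mult complex_field = (*)" "monoid.one complex_field = 1"
  "ring.zero complex_field = 0" "ring.add complex_field = (+)"
  by (simp_all add: ring_of_type_algebra_def fun_eq_iff)

lemma complex_field_inverse:
  "\<ominus>\<^bsub>complex_field\<^esub> x = - x" "x \<noteq> 0 \<Longrightarrow> inv\<^bsub>complex_field\<^esub> x = inverse x"
proof -
  interpret field complex_field by (rule field_from_type_algebra)
  show "\<ominus>\<^bsub>complex_field\<^esub> x = - x"
    by (rule minus_equality) (simp_all add: complex_field_sel)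
  show "inv\<^bsub>complex_field\<^esub> x = inverse x" if "x \<noteq> 0"
    using that by (intro inv_char) (simp_all add: complex_field_sel)
qed

lemma rat_adjoin_incl: "\<rat> \<subseteq> rat_adjoin S" "S \<subseteq> rat_adjoin S"
  by (auto simp: rat_adjoin_def intro: generate_field.incl)

lemma subfield_rat_adjoin: "subfield_set (rat_adjoin S)"
proof
  have uminus: "- x \<in> rat_adjoin S" if "x \<in> rat_adjoin S" for x
    using generate_field.a_inv[of x complex_field "\<rat> \<union> S"] that
    by (simp add: rat_adjoin_def complex_field_inverse)
  fix x y assume x: "x \<in> rat_adjoin S" and y: "y \<in> rat_adjoin S"
  show "x - y \<in> rat_adjoin S"
    using generate_field.eng_add[of x complex_field "\<rat> \<union> S" "- y"] x uminus[OF y]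
    by (simp add: rat_adjoin_def complex_field_sel)
  show "x * y \<in> rat_adjoin S"
    using generate_field.eng_mult[of x complex_field "\<rat> \<union> S" y] x y
    by (simp add: rat_adjoin_def complex_field_sel)
next
  show "1 \<in> rat_adjoin S" using rat_adjoin_incl(1) Rats_1 by (rule subsetD)
  fix x assume x: "x \<in> rat_adjoin S"
  show "inverse x \<in> rat_adjoin S"
    using generate_field.m_inv[of x complex_field "\<rat> \<union> S"] x
    by (cases "x = 0") (simp_all add: rat_adjoin_def complex_field_sel complex_field_inverse)
qed

lemma rat_adjoin_least:
  assumes "subfield_set L" "\<rat> \<subseteq> L" "S \<subseteq> L"
  shows "rat_adjoin S \<subseteq> L"
proof
  interpret subfield_set L by fact
  fix x assume "x \<in> rat_adjoin S"
  then show "x \<in> L" unfolding rat_adjoin_def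
  proof (induction rule: generate_field.induct)
    case (m_inv h)
    then show ?case by (auto simp: complex_field_sel complex_field_inverse intro: inverse_mem)
  qed (use assms in \<open>auto simp: complex_field_sel complex_field_inverse
         intro: one_mem uminus_mem add_mem mult_mem\<close>)
qed

section \<open>The Galois group and invariance of the trace\<close>

lemma galois_group_rat_iff:
  "\<sigma> \<in> galois_group_rat K \<longleftrightarrow>
     \<sigma> \<in> extensional K \<and> bij_betw \<sigma> K K \<and>
     (\<forall>x\<in>K. \<forall>y\<in>K. \<sigma> (x + y) = \<sigma> x + \<sigma> y \<and> \<sigma> (x * y) = \<sigma> x * \<sigma> y) \<and>
     \<sigma> 1 = 1 \<and> (\<forall>q\<in>\<rat>. \<sigma> q = q)"
  unfolding galois_group_rat_def ring_iso_def ring_hom_def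
  by (auto simp: complex_field_sel bij_betw_def)

context
  fixes K :: "complex set"
  assumes K: "subfield_set K"
begin

interpretation subfield_set K by (fact K)

lemma galois_group_rat_diff:
  assumes "\<sigma> \<in> galois_group_rat K" "x \<in> K" "y \<in> K"
  shows "\<sigma> (x - y) = \<sigma> x - \<sigma> y"
proof -
  have "\<sigma> ((x - y) + y) = \<sigma> (x - y) + \<sigma> y"
    using assms diff_mem[of x y] unfolding galois_group_rat_iff by blast
  then show ?thesis by simp
qed

lemma galois_group_rat_mult:
  assumes "\<sigma> \<in> galois_group_rat K" "x \<in> K" "y \<in> K"
  shows "\<sigma> (x * y) = \<sigma> x * \<sigma> y"
  using assms unfolding galois_group_rat_iff by blast

lemma galois_group_rat_power:
  assumes "\<sigma> \<in> galois_group_rat K" "x \<in> K"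
  shows "\<sigma> (x ^ n) = \<sigma> x ^ n"
proof (induction n)
  case 0
  then show ?case using assms unfolding galois_group_rat_iff by auto
next
  case (Suc n)
  then show ?case using galois_group_rat_mult[OF assms power_mem[OF assms(2)], of n] by simp
qed

lemma galois_group_rat_mem:
  assumes "\<sigma> \<in> galois_group_rat K" "x \<in> K"
  shows "\<sigma> x \<in> K"
  using assms unfolding galois_group_rat_iff by (auto dest: bij_betwE)

lemma galois_group_rat_compose:
  assumes "\<sigma> \<in> galois_group_rat K" "\<tau> \<in> galois_group_rat K"
  shows "compose K \<tau> \<sigma> \<in> galois_group_rat K"
  unfolding galois_group_rat_iff
proof (intro conjI ballI)
  show "bij_betw (compose K \<tau> \<sigma>) K K"
    using assms unfolding galois_group_rat_iff by (auto intro: bij_betw_compose)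
qed (use assms one_mem galois_group_rat_mem[OF assms(1)] in
      \<open>auto simp: galois_group_rat_iff compose_def add_mem mult_mem restrict_def
        extensional_def\<close>)

lemma galois_group_rat_inverse:
  assumes "\<sigma> \<in> galois_group_rat K" "\<rat> \<subseteq> K"
  shows "restrict (inv_into K \<sigma>) K \<in> galois_group_rat K"
proof -
  have bij: "bij_betw \<sigma> K K" using assms unfolding galois_group_rat_iff by blast
  define \<tau> where "\<tau> = restrict (inv_into K \<sigma>) K"
  have \<tau>: "\<tau> x \<in> K" "\<sigma> (\<tau> x) = x" if "x \<in> K" for x
    using that bij_betw_inv_into_right[OF bij that] bij_betwE[OF bij_betw_inv_into[OF bij]]
    by (auto simp: \<tau>_def)
  \<comment> \<open>Each law for the inverse \<tau> is checked after applying \<sigma>, where it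
    becomes the corresponding law for \<sigma>.\<close>
  have eqI: "\<tau> x = y" if "y \<in> K" "\<sigma> y = x" for x y
    using bij_betw_inv_into_left[OF bij that(1)] galois_group_rat_mem[OF assms(1) that(1)] that(2)
    by (auto simp: \<tau>_def)
  show ?thesis
    unfolding \<tau>_def[symmetric] galois_group_rat_iff
  proof (intro conjI ballI)
    show "\<tau> \<in> extensional K" by (simp add: \<tau>_def)
    show "bij_betw \<tau> K K" unfolding \<tau>_def bij_betw_restrict_eq
      by (rule bij_betw_inv_into[OF bij])
    show "\<tau> 1 = 1" using assms(1) by (intro eqI one_mem) (simp add: galois_group_rat_iff)
    show "\<tau> q = q" if "q \<in> \<rat>" for q
      using that assms by (intro eqI) (auto simp: galois_group_rat_iff)
    fix x y assume xy: "x \<in> K" "y \<in> K"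
    show "\<tau> (x + y) = \<tau> x + \<tau> y"
      using assms(1) xy \<tau> by (intro eqI add_mem) (simp_all add: galois_group_rat_iff)
    show "\<tau> (x * y) = \<tau> x * \<tau> y"
      using xy \<tau> by (intro eqI mult_mem) (simp_all add: galois_group_rat_mult[OF assms(1)])
  qed
qed

text \<open>Right composition with \<sigma> permutes the Galois group, its inverse being composition
  with \<rho>, so the sum is only reordered. Using \<open>compose K\<close> keeps the maps
  extensional, so these identities hold as equalities of functions.\<close>

lemma galois_trace_conj:
  assumes "\<sigma> \<in> galois_group_rat K" "\<rat> \<subseteq> K" "x \<in> K"
  shows "galois_trace K (\<sigma> x) = galois_trace K x"
proof -
  define \<rho> where "\<rho> = restrict (inv_into K \<sigma>) K"
  have \<rho>: "\<rho> \<in> galois_group_rat K"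
    using galois_group_rat_inverse[OF assms(1,2)] by (simp add: \<rho>_def)
  have bij: "bij_betw \<sigma> K K" using assms unfolding galois_group_rat_iff by blast
  have inv: "\<sigma> (\<rho> y) = y" "\<rho> (\<sigma> y) = y" if "y \<in> K" for y
    using that galois_group_rat_mem[OF assms(1) that]
    by (simp_all add: \<rho>_def bij_betw_inv_into_right[OF bij] bij_betw_inv_into_left[OF bij])
  have ext: "compose K (compose K \<tau> \<rho>) \<sigma> = \<tau>" "compose K (compose K \<tau> \<sigma>) \<rho> = \<tau>"
    if "\<tau> \<in> galois_group_rat K" for \<tau>
  proof -
    have \<tau>: "\<tau> \<in> extensional K" using that by (simp add: galois_group_rat_iff)
    show "compose K (compose K \<tau> \<rho>) \<sigma> = \<tau>"
      by (rule extensionalityI[OF compose_extensional \<tau>])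
        (simp add: compose_eq inv galois_group_rat_mem[OF assms(1)])
    show "compose K (compose K \<tau> \<sigma>) \<rho> = \<tau>"
      by (rule extensionalityI[OF compose_extensional \<tau>])
        (simp add: compose_eq inv galois_group_rat_mem[OF \<rho>])
  qed
  show ?thesis unfolding galois_trace_def
  proof (rule sum.reindex_bij_witness[where i = "\<lambda>\<tau>. compose K \<tau> \<rho>" and j = "\<lambda>\<tau>. compose K \<tau> \<sigma>"])
    fix \<tau> assume "\<tau> \<in> galois_group_rat K"
    then show "compose K \<tau> \<sigma> \<in> galois_group_rat K" "compose K \<tau> \<rho> \<in> galois_group_rat K"
      using galois_group_rat_compose assms(1) \<rho> by auto
  qed (use ext assms(3) in \<open>auto simp: compose_eq\<close>)
qed

lemma galois_trace_diff:
  assumes "x \<in> K" "y \<in> K"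
  shows "galois_trace K (x - y) = galois_trace K x - galois_trace K y"
  unfolding galois_trace_def sum_subtractf[symmetric]
  by (intro sum.cong refl galois_group_rat_diff assms)

end

section \<open>Roots of unity and the cyclotomic norm\<close>

text \<open>The \<open>p\<close> powers are distinct solutions of \<open>z ^ p = 1\<close>, which
  has exactly \<open>p\<close> complex solutions.\<close>

lemma powers_primitive_root:
  assumes "primitive_root_of_unity p w"
  shows "inj_on (\<lambda>j. w ^ j) {0..<p}" and "(\<lambda>j. w ^ j) ` {0..<p} = {z. z ^ p = 1}"
proof -
  have p: "p > 0" and wp: "w ^ p = 1" and prim: "\<And>k. 0 < k \<Longrightarrow> k < p \<Longrightarrow> w ^ k \<noteq> 1"
    using assms by (auto simp: primitive_root_of_unity_def)
  have w0: "w \<noteq> 0" using p wp by (auto simp: power_0_left)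
  have *: "w ^ i \<noteq> w ^ j" if "i < j" "j < p" for i j
  proof
    assume "w ^ i = w ^ j"
    moreover have "w ^ j = w ^ i * w ^ (j - i)"
      using that by (simp flip: power_add)
    ultimately have "w ^ (j - i) = 1" using w0 by simp
    then show False using prim[of "j - i"] that by simp
  qed
  show inj: "inj_on (\<lambda>j. w ^ j) {0..<p}"
    by (rule linorder_inj_onI') (use * in auto)
  have "card ((\<lambda>j. w ^ j) ` {0..<p}) = card {z::complex. z ^ p = 1}"
    using card_image[OF inj] card_roots_unity_eq[OF p] by simp
  moreover have "(\<lambda>j. w ^ j) ` {0..<p} \<subseteq> {z. z ^ p = 1}"
  proof safe
    fix j
    have "(w ^ j) ^ p = (w ^ p) ^ j" by (simp add: mult.commute flip: power_mult)
    then show "(w ^ j) ^ p = 1" by (simp add: wp)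
  qed
  ultimately show "(\<lambda>j. w ^ j) ` {0..<p} = {z. z ^ p = 1}"
    using finite_roots_unity[of p] p by (intro card_subset_eq) auto
qed

text \<open>This replaces the exponents in the norm by the roots themselves, a set on which
  automorphisms act.\<close>

lemma bij_betw_nontrivial_powers:
  assumes "primitive_root_of_unity p w"
  shows "bij_betw (\<lambda>j. w ^ j) {1..p - 1} {z. z ^ p = 1 \<and> z \<noteq> 1}"
proof -
  have p: "p > 0" using assms by (auto simp: primitive_root_of_unity_def)
  have "bij_betw (\<lambda>j. w ^ j) ({0..<p} - {0}) ({z. z ^ p = 1} - {w ^ 0})"
    using powers_primitive_root[OF assms] p
    by (intro bij_betw_DiffI) (auto simp: bij_betw_def)
  moreover have "{0..<p} - {0} = {1..p - 1}" by auto
  moreover have "{z. z ^ p = 1} - {w ^ 0} = {z. z ^ p = 1 \<and> z \<noteq> 1}" by auto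
  ultimately show ?thesis by simp
qed

text \<open>This is the normality of Q(w): every possible image of \<open>w\<close> stays in the
  field.\<close>

lemma roots_unity_in_rat_adjoin:
  assumes "primitive_root_of_unity p w" "z ^ p = 1"
  shows "z \<in> rat_adjoin {w}"
proof -
  interpret subfield_set "rat_adjoin {w}" by (rule subfield_rat_adjoin)
  have "z \<in> (\<lambda>j. w ^ j) ` {0..<p}" using powers_primitive_root[OF assms(1)] assms(2) by simp
  then show ?thesis using rat_adjoin_incl(2)[of "{w}"] by (auto intro: power_mem)
qed

text \<open>Reindexing the sum by \<sigma> turns the trace of \<open>\<sigma> x * u\<close> into
  that of \<open>\<sigma> (x * u)\<close>, which is the trace of \<open>x * u\<close>.\<close>

lemma cyclotomic_norm_conj:
  assumes w: "primitive_root_of_unity p w" and \<sigma>: "\<sigma> \<in> galois_group_rat (rat_adjoin {w})"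
    and x: "x \<in> rat_adjoin {w}"
  shows "cyclotomic_norm p w (\<sigma> x) = cyclotomic_norm p w x"
proof -
  define K where "K = rat_adjoin {w}"
  define U where "U = {z::complex. z ^ p = 1 \<and> z \<noteq> 1}"
  have K: "subfield_set K" unfolding K_def by (rule subfield_rat_adjoin)
  have \<sigma>K: "\<sigma> \<in> galois_group_rat K" and xK: "x \<in> K" using \<sigma> x by (auto simp: K_def)
  have QK: "\<rat> \<subseteq> K" unfolding K_def by (rule rat_adjoin_incl)
  have UK: "U \<subseteq> K" unfolding U_def K_def using roots_unity_in_rat_adjoin[OF w] by auto
  have "p > 0" using w by (simp add: primitive_root_of_unity_def)
  then have "finite U" unfolding U_def
    by (intro finite_subset[OF _ finite_roots_unity[of p]]) auto
  moreover have inj: "inj_on \<sigma> K" and s1: "\<sigma> 1 = 1"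
    using \<sigma>K unfolding galois_group_rat_iff bij_betw_def by auto
  moreover have "\<sigma> ` U \<subseteq> U"
  proof
    fix y assume "y \<in> \<sigma> ` U"
    then obtain z where z: "z \<in> U" "y = \<sigma> z" by auto
    then have "y ^ p = 1"
      using galois_group_rat_power[OF K \<sigma>K, of z p] UK s1 by (auto simp: U_def)
    moreover have "y \<noteq> 1"
      using inj_onD[OF inj, of z 1] z s1 subsetD[OF UK z(1)] subsetD[OF QK Rats_1]
      by (auto simp: U_def)
    ultimately show "y \<in> U" by (simp add: U_def)
  qed
  \<comment> \<open>An injective self-map of a finite set is surjective.\<close>
  ultimately have bij: "bij_betw \<sigma> U U"
    unfolding bij_betw_def using endo_inj_surj[of U \<sigma>] inj_on_subset[OF inj UK] by blast
  have norm: "cyclotomic_norm p w y = sqrt (\<Sum>u\<in>U. (Re (galois_trace K (y * u)))\<^sup>2)" for y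
    unfolding cyclotomic_norm_def K_def U_def
    by (subst sum.reindex_bij_betw[OF bij_betw_nontrivial_powers[OF w], symmetric]) simp
  have "(\<Sum>u\<in>U. (Re (galois_trace K (\<sigma> x * u)))\<^sup>2)
      = (\<Sum>u\<in>U. (Re (galois_trace K (\<sigma> x * \<sigma> u)))\<^sup>2)"
    by (rule sum.reindex_bij_betw[OF bij, symmetric])
  also have "\<dots> = (\<Sum>u\<in>U. (Re (galois_trace K (x * u)))\<^sup>2)"
  proof (rule sum.cong[OF refl])
    fix u assume "u \<in> U"
    then have uK: "u \<in> K" using UK by auto
    have "galois_trace K (\<sigma> x * \<sigma> u) = galois_trace K (\<sigma> (x * u))"
      using galois_group_rat_mult[OF K \<sigma>K xK uK] by simp
    also have "\<dots> = galois_trace K (x * u)"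
      by (intro galois_trace_conj[OF K \<sigma>K QK] subfield_set.mult_mem[OF K] xK uK)
    finally show "(Re (galois_trace K (\<sigma> x * \<sigma> u)))\<^sup>2 = (Re (galois_trace K (x * u)))\<^sup>2" by simp
  qed
  finally show ?thesis by (simp add: norm)
qed

text \<open>The norm is the Euclidean length of a vector of traces that depends additively on the
  element, so Minkowski's inequality applies.\<close>

lemma cyclotomic_norm_diff:
  assumes "x \<in> rat_adjoin {w}" "y \<in> rat_adjoin {w}"
  shows "cyclotomic_norm p w (x - y) \<le> cyclotomic_norm p w x + cyclotomic_norm p w y"
proof -
  interpret subfield_set "rat_adjoin {w}" by (rule subfield_rat_adjoin)
  define T where "T z j = Re (galois_trace (rat_adjoin {w}) (z * w ^ j))" for z j
  have norm: "cyclotomic_norm p w z = L2_set (T z) {1..p - 1}" for z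
    by (simp add: cyclotomic_norm_def L2_set_def T_def)
  have "w ^ j \<in> rat_adjoin {w}" for j
    using rat_adjoin_incl(2)[of "{w}"] by (auto intro: power_mem)
  then have "T (x - y) j = T x j + - T y j" for j
    unfolding T_def using assms
    by (simp add: left_diff_distrib galois_trace_diff[OF subfield_rat_adjoin] mult_mem)
  then have "L2_set (T (x - y)) {1..p - 1} = L2_set (\<lambda>j. T x j + - T y j) {1..p - 1}"
    by (intro L2_set_cong) auto
  also have "\<dots> \<le> L2_set (T x) {1..p - 1} + L2_set (\<lambda>j. - T y j) {1..p - 1}"
    by (rule L2_set_triangle_ineq)
  finally show ?thesis by (simp add: norm L2_set_def)
qed

section \<open>Automorphisms over an intermediate field\<close>

text \<open>Let \<open>m\<close> be the minimal polynomial of \<open>w\<close> over \<open>F\<close>; as a divisor of \<open>X\<^sup>p - 1\<close>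
  it has \<open>deg m\<close> distinct roots \<open>w'\<close>, and \<open>w \<mapsto> w'\<close> extends to an automorphism over \<open>F\<close>.
  If all of these fix \<open>x = g(w)\<close>, where \<open>deg g < deg m\<close>, then \<open>g - x\<close> vanishes at all
  \<open>w'\<close>, so \<open>g\<close> is the constant \<open>x\<close>.\<close>
lemma galois_moves_outside_subfield:
  assumes w: "primitive_root_of_unity p w"
    and F: "subfield_set F" "\<rat> \<subseteq> F" "F \<subseteq> rat_adjoin {w}"
    and x: "x \<in> rat_adjoin {w}" "x \<notin> F"
  shows "\<exists>\<sigma>\<in>galois_group_rat (rat_adjoin {w}). (\<forall>y\<in>F. \<sigma> y = y) \<and> \<sigma> x \<noteq> x"
proof -
  interpret subfield_set F by fact
  define K where "K = rat_adjoin {w}"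
  have K: "subfield_set K" unfolding K_def by (rule subfield_rat_adjoin)
  interpret K: subfield_set K by fact
  have FK: "F \<subseteq> K" using F(3) by (simp add: K_def)
  \<comment> \<open>\<open>f\<close> shows that \<open>w\<close> is algebraic over \<open>F\<close>,
    and its \<open>p\<close> distinct roots supply the separability used below.\<close>
  define f :: "complex poly" where "f = monom 1 p - 1"
  have p: "p > 0" and wp: "w ^ p = 1" using w by (auto simp: primitive_root_of_unity_def)
  have f: "f \<in> polys"
    unfolding f_def one_pCons by (intro polys_diff polys_monom polys_const one_mem)
  have polyf: "poly f z = z ^ p - 1" for z by (simp add: f_def poly_monom)
  have degf: "degree f = p"
    unfolding f_def diff_conv_add_uminus
    by (subst degree_add_eq_left) (use p in \<open>auto simp: degree_monom_eq\<close>)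
  then have f0: "f \<noteq> 0" using p by auto
  obtain m where "minimal_poly F w m"
    using exists_minimal_poly[OF f f0] polyf wp by auto
  then interpret minimal_poly F w m .
  \<comment> \<open>F[w] is a field that contains the rationals and \<open>w\<close>, hence all of
    \<open>K\<close>; the maps \<open>conj_map w'\<close> are therefore defined on exactly
    \<open>K\<close>.\<close>
  have img: "(\<lambda>g. poly g w) ` polys = K"
  proof
    have wK: "w \<in> K" using rat_adjoin_incl(2)[of "{w}"] by (simp add: K_def)
    show "(\<lambda>g. poly g w) ` polys \<subseteq> K"
    proof safe
      fix g assume "g \<in> polys"
      then have "g \<in> K.polys" using FK by (auto simp: polys_def K.polys_def)
      then show "poly g w \<in> K" using wK by (rule K.poly_mem)
    qed
    have "\<rat> \<subseteq> (\<lambda>g. poly g w) ` polys"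
    proof
      fix q :: complex assume "q \<in> \<rat>"
      then show "q \<in> (\<lambda>g. poly g w) ` polys"
        using polys_const[of q] F(2) by (auto intro!: image_eqI[of _ _ "[:q:]"])
    qed
    moreover have "{w} \<subseteq> (\<lambda>g. poly g w) ` polys"
      using polys_monom[OF one_mem, of 1] by (auto intro!: image_eqI[of _ _ "monom 1 1"] simp: poly_monom)
    ultimately show "K \<subseteq> (\<lambda>g. poly g w) ` polys"
      unfolding K_def by (intro rat_adjoin_least subfield_adjoin)
  qed
  obtain q where q: "q \<in> polys" "f = q * m"
    using root_imp_multiple[OF f] polyf wp by auto
  \<comment> \<open>Of the \<open>p\<close> distinct roots of \<open>f = q * m\<close>, at most
    \<open>degree q\<close> belong to \<open>q\<close>, which leaves at least
    \<open>degree m\<close> for \<open>m\<close>.\<close>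
  have roots_card: "degree m \<le> card {z. poly m z = 0}"
  proof -
    have nz: "q \<noteq> 0" "m \<noteq> 0" using q f0 by auto
    have "{z. z ^ p = 1} = {z. poly q z = 0} \<union> {z. poly m z = 0}"
      using polyf q(2) by (auto simp: diff_eq_eq) (metis mult_eq_0_iff poly_mult right_minus_eq)+
    then have "p \<le> card {z. poly q z = 0} + card {z. poly m z = 0}"
      using card_roots_unity_eq[OF p] card_Un_le by metis
    moreover have "card {z. poly q z = 0} \<le> degree q" using nz by (intro card_poly_roots_bound)
    moreover have "p = degree q + degree m" using degf q(2) nz degree_mult_eq by metis
    ultimately show ?thesis by linarith
  qed
  have const: "conj_map w' y = y" if "poly m w' = 0" "y \<in> F" for w' y
    using conj_map_poly[OF that(1) polys_const[OF that(2)]] by simp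
  have gal: "conj_map w' \<in> galois_group_rat K" if w': "poly m w' = 0" for w'
  proof -
    note c = conj_map_poly[OF w']
    have hom: "conj_map w' (y + z) = conj_map w' y + conj_map w' z"
      "conj_map w' (y * z) = conj_map w' y * conj_map w' z"
      if yz: "y \<in> K" "z \<in> K" for y z
    proof -
      obtain g h where "g \<in> polys" "y = poly g w" "h \<in> polys" "z = poly h w"
        using yz unfolding img[symmetric] by blast
      then show "conj_map w' (y + z) = conj_map w' y + conj_map w' z"
        "conj_map w' (y * z) = conj_map w' y * conj_map w' z"
        using c[of "g + h"] c[of "g * h"] c[of g] c[of h] by (auto simp: polys_add polys_mult)
    qed
    have inj: "inj_on (conj_map w') K" using inj_on_conj_map[OF w'] img by simp
    have into: "conj_map w' ` K \<subseteq> K"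
    proof safe
      fix y assume "y \<in> K"
      then obtain g where g: "g \<in> polys" "y = poly g w" unfolding img[symmetric] by auto
      have "w' ^ p = 1" using polyf[of w'] q(2) w' by simp
      then have "w' \<in> K" unfolding K_def by (intro roots_unity_in_rat_adjoin[OF w])
      moreover have "g \<in> K.polys" using g FK by (auto simp: polys_def K.polys_def)
      ultimately show "conj_map w' y \<in> K" using g c K.poly_mem by simp
    qed
    \<comment> \<open>Surjectivity starts from the finite set \<open>U\<close>: the map is injective
      on it and preserves it, so \<open>w\<close> itself is the image of some
      \<open>u\<close>.\<close>
    define U where "U = {z::complex. z ^ p = 1}"
    have UK: "U \<subseteq> K" unfolding U_def K_def using roots_unity_in_rat_adjoin[OF w] by auto
    have one: "conj_map w' 1 = 1" using const[OF w' one_mem] .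
    have pow: "conj_map w' (z ^ n) = conj_map w' z ^ n" if "z \<in> K" for z n
      by (induction n) (use that hom one in \<open>auto simp: K.power_mem\<close>)
    have "conj_map w' ` U \<subseteq> U"
    proof safe
      fix z assume "z \<in> U"
      then show "conj_map w' z \<in> U"
        using pow[of z p] UK one by (auto simp: U_def)
    qed
    moreover have "finite U" unfolding U_def using p by (intro finite_roots_unity) auto
    ultimately have "conj_map w' ` U = U"
      using endo_inj_surj inj_on_subset[OF inj UK] by blast
    moreover have "w \<in> U" using wp by (simp add: U_def)
    ultimately obtain u where u: "u \<in> K" "w = conj_map w' u" using UK by blast
    have "K \<subseteq> conj_map w' ` K"
    proof
      fix y assume "y \<in> K"
      then obtain g where g: "g \<in> polys" "y = poly g w" unfolding img[symmetric] by auto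
      obtain h where h: "h \<in> polys" "u = poly h w" using u unfolding img[symmetric] by auto
      \<comment> \<open>With \<open>y = g(w)\<close> and \<open>u = h(w)\<close>, the preimage of
        \<open>y\<close> is \<open>g(u)\<close>: its image is \<open>g(h(w'))\<close>, and
        \<open>h(w')\<close> is the image of \<open>u\<close>, that is \<open>w\<close>.\<close>
      have gh: "pcompose g h \<in> polys" using g(1) h(1) by (rule polys_pcompose)
      have "conj_map w' (poly (pcompose g h) w) = poly (pcompose g h) w'" by (rule c[OF gh])
      also have "\<dots> = y" using u h g c[of h] by (simp add: poly_pcompose)
      finally show "y \<in> conj_map w' ` K" using gh img by (metis imageI)
    qed
    with inj into have "bij_betw (conj_map w') K K" by (auto simp: bij_betw_def)
    moreover have "conj_map w' \<in> extensional K" by (simp add: conj_map_def img)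
    ultimately show ?thesis
      unfolding galois_group_rat_iff using hom one const[OF w'] F(2) by auto
  qed
  obtain g where g: "g \<in> polys" "degree g < degree m" "poly g w = x"
    using x(1) low_degree_representative unfolding K_def[symmetric] img[symmetric] by auto
  have "\<exists>w'. poly m w' = 0 \<and> poly g w' \<noteq> x"
  proof (rule ccontr)
    assume "\<not> ?thesis"
    then have sub: "{z. poly m z = 0} \<subseteq> {z. poly (g - [:x:]) z = 0}" by auto
    have "g - [:x:] = 0"
    proof (rule ccontr)
      assume nz: "g - [:x:] \<noteq> 0"
      have "degree m \<le> card {z. poly (g - [:x:]) z = 0}"
        using roots_card card_mono[OF poly_roots_finite[OF nz] sub] by linarith
      also have "\<dots> \<le> degree (g - [:x:])" using nz by (rule card_poly_roots_bound)
      also have "\<dots> \<le> degree g" by (intro degree_diff_le) auto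
      finally show False using g(2) by simp
    qed
    \<comment> \<open>The constant coefficient of \<open>g\<close> lies in \<open>F\<close>, whereas
      \<open>x\<close> does not.\<close>
    then have "coeff g 0 = x" by simp
    then show False using g(1) x(2) by (auto simp: polys_def)
  qed
  then obtain w' where "poly m w' = 0" "poly g w' \<noteq> x" by blast
  then show ?thesis
    using gal const conj_map_poly[of w' g] g unfolding K_def by (intro bexI[of _ "conj_map w'"]) auto
qed

section \<open>Krasner's argument for the trace norm\<close>

theorem theorem3p3:
  fixes p n :: nat and \<omega> \<alpha> \<beta> :: complex and K :: "complex set" and a :: "nat \<Rightarrow> complex"
  assumes "prime p" and "odd p"
    and "primitive_root_of_unity p \<omega>"
    and "K = rat_adjoin {\<omega>}"
    and "\<alpha> \<in> K"
    and "bij_betw a {1..n} (galois_conjugates K \<alpha>)" and "a 1 = \<alpha>"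
    and "\<beta> \<in> K"
    and "\<And>i. 2 \<le> i \<Longrightarrow> i \<le> n \<Longrightarrow>
           cyclotomic_dist p \<omega> \<alpha> \<beta> < 1 / 2 * cyclotomic_dist p \<omega> \<alpha> (a i)"
  shows "rat_adjoin {\<alpha>} \<subseteq> rat_adjoin {\<beta>}"
proof -
  have K: "subfield_set K" unfolding assms(4) by (rule subfield_rat_adjoin)
  interpret subfield_set K by fact
  note KF = \<open>K = rat_adjoin {\<omega>}\<close>
  have QK: "\<rat> \<subseteq> K" using rat_adjoin_incl by (simp add: KF)
  have "\<alpha> \<in> rat_adjoin {\<beta>}"
  proof (rule ccontr)
    assume "\<alpha> \<notin> rat_adjoin {\<beta>}"
    moreover have "rat_adjoin {\<beta>} \<subseteq> K"
      using QK \<open>\<beta> \<in> K\<close> by (intro rat_adjoin_least K) auto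
    ultimately obtain \<sigma> where \<sigma>: "\<sigma> \<in> galois_group_rat K"
      and fixed: "\<forall>y\<in>rat_adjoin {\<beta>}. \<sigma> y = y" and moves: "\<sigma> \<alpha> \<noteq> \<alpha>"
      using galois_moves_outside_subfield[OF assms(3) subfield_rat_adjoin rat_adjoin_incl(1)]
        \<open>\<alpha> \<in> K\<close> unfolding KF by metis
    have "\<sigma> \<alpha> \<in> a ` {1..n}"
      using \<sigma> assms(6) by (auto simp: galois_conjugates_def bij_betw_def)
    then obtain i where i: "i \<in> {1..n}" "\<sigma> \<alpha> = a i" by auto
    \<comment> \<open>Since \<sigma> moves \<alpha>, the index of the conjugate is at least 2 and
      the distance hypothesis covers it.\<close>
    then have "i \<noteq> 1" using moves \<open>a 1 = \<alpha>\<close> by auto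
    then have lt: "cyclotomic_dist p \<omega> \<alpha> \<beta> < 1 / 2 * cyclotomic_dist p \<omega> \<alpha> (\<sigma> \<alpha>)"
      using assms(9)[of i] i by auto
    have "\<sigma> \<beta> = \<beta>" using fixed rat_adjoin_incl(2)[of "{\<beta>}"] by auto
    \<comment> \<open>Insert \<beta> and use that it equals its own image under \<sigma>.\<close>
    then have eq: "\<alpha> - \<sigma> \<alpha> = (\<alpha> - \<beta>) - \<sigma> (\<alpha> - \<beta>)"
      using galois_group_rat_diff[OF K \<sigma> \<open>\<alpha> \<in> K\<close> \<open>\<beta> \<in> K\<close>] by simp
    have d: "\<alpha> - \<beta> \<in> K" using \<open>\<alpha> \<in> K\<close> \<open>\<beta> \<in> K\<close> by (rule diff_mem)
    have "cyclotomic_norm p \<omega> (\<alpha> - \<sigma> \<alpha>)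
        \<le> cyclotomic_norm p \<omega> (\<alpha> - \<beta>) + cyclotomic_norm p \<omega> (\<sigma> (\<alpha> - \<beta>))"
      unfolding eq using d galois_group_rat_mem[OF K \<sigma> d]
      unfolding KF by (rule cyclotomic_norm_diff)
    also have "cyclotomic_norm p \<omega> (\<sigma> (\<alpha> - \<beta>)) = cyclotomic_norm p \<omega> (\<alpha> - \<beta>)"
      using cyclotomic_norm_conj[OF assms(3)] \<sigma> d unfolding KF by blast
    finally show False using lt by (simp add: cyclotomic_dist_def)
  qed
  then show ?thesis
    using rat_adjoin_incl(1) by (intro rat_adjoin_least subfield_rat_adjoin) auto
qed

end
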